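(* Let $\alpha$ and $\beta$ be probability measures on $\mathcal X$ and $\mathcal Y$ respectively, where $\mathcal X,\mathcal Y$ are subsets of $\mathbb R^d$ with diameters satisfying $|\mathcal X|=|\mathcal Y|\le D$, and assume that the cost $c:\mathcal X\times\mathcal Y\to\mathbb R$ is $L$-Lipschitz with respect to $x$ and with respect to $y$ (with $L,D>0$). Then, for every $\varepsilon>0$, $$0\le W_\varepsilon(\alpha,\beta)-W(\alpha,\beta)\le 2\varepsilon d\,\log\!\left(\frac{e^2\, L\, D}{\sqrt d\,\varepsilon}\right),$$ and the right-hand side satisfies $2\varepsilon d\,\log\!\left(\frac{e^2 L D}{\sqrt d\,\varepsilon}\right)\sim 2\varepsilon d\log(1/\varepsilon)$ as $\varepsilon\to0$.
   Context: The diameter of a set $\mathcal X\subset\mathbb R^d$ is $|\mathcal X|=\sup\{\|x-x'\| : x,x'\in\mathcal X\}$. $\Pi(\alpha,\beta)$ is the set of probability measures $\pi$ on $\mathcal X\times\mathcal Y$ with first marginal $\alpha$ and second marginal $\beta$. The (unregularized) optimal transport cost is $$W(\alpha,\beta)=\min_{\pi\in\Pi(\alpha,\beta)}\int_{\mathcal X\times\mathcal Y}c(x,y)\,d\pi(x,y),$$ and for $\varepsilon>0$ the entropy-regularized cost is $$W_\varepsilon(\alpha,\beta)=\min_{\pi\in\Pi(\alpha,\beta)}\int_{\mathcal X\times\mathcal Y}c(x,y)\,d\pi(x,y)+\varepsilon H(\pi\mid\alpha\otimes\beta),$$ where $H(\pi\mid\alpha\otimes\beta)=\int_{\mathcal X\times\mathcal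 Y}\log\left(\frac{d\pi(x,y)}{d\alpha(x)d\beta(y)}\right)d\pi(x,y)$ is the relative entropy of $\pi$ with respect to the product measure $\alpha\otimes\beta$ (equal to $+\infty$ if $\pi$ is not absolutely continuous with respect to $\alpha\otimes\beta$).
   Formalization: The upper bound is proved only for ε with √d·ε ≤ e·L·D (logarithm at least 1), not for every ε>0; as stated it fails for large ε, where the right-hand side is negative while the difference is nonnegative (e.g. Dirac masses). *)

theory Defs
  imports "HOL-Probability.Probability" "HOL-Library.Landau_Symbols"
begin

(* A probability measure on X carries the trace on X of the Borel sigma-algebra;
   X itself need not be a Borel set. *)
definition prob_measure_on :: "'a::topological_space set \<Rightarrow> 'a measure \<Rightarrow> bool" where
  "prob_measure_on X \<alpha> \<longleftrightarrow> prob_space \<alpha> \<and> sets \<alpha> = sets (restrict_space borel X)"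

definition couplings :: "'a measure \<Rightarrow> 'b measure \<Rightarrow> ('a \<times> 'b) measure set" where
  "couplings \<alpha> \<beta> = {\<pi>. prob_space \<pi> \<and> sets \<pi> = sets (\<alpha> \<Otimes>\<^sub>M \<beta>)
     \<and> distr \<pi> \<alpha> fst = \<alpha> \<and> distr \<pi> \<beta> snd = \<beta>}"

definition transport_cost :: "('a \<Rightarrow> 'b \<Rightarrow> real) \<Rightarrow> ('a \<times> 'b) measure \<Rightarrow> real" where
  "transport_cost c \<pi> = (\<integral>p. c (fst p) (snd p) \<partial>\<pi>)"

(* KL_divergence is a Bochner integral, with junk value 0 where it diverges. For probability
   measures \<pi> << \<mu> the negative part of log (d\<pi>/d\<mu>) is always \<pi>-integrable, so
   non-integrability means that the relative entropy is +\<infinity>. *)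
definition relative_entropy :: "'a measure \<Rightarrow> 'a measure \<Rightarrow> ereal" where
  "relative_entropy \<pi> \<mu> =
     (if absolutely_continuous \<mu> \<pi> \<and> integrable \<pi> (entropy_density (exp 1) \<mu> \<pi>)
      then ereal (KL_divergence (exp 1) \<mu> \<pi>) else \<infinity>)"

definition OT_cost :: "('a \<Rightarrow> 'b \<Rightarrow> real) \<Rightarrow> 'a measure \<Rightarrow> 'b measure \<Rightarrow> ereal" where
  "OT_cost c \<alpha> \<beta> = (INF \<pi>\<in>couplings \<alpha> \<beta>. ereal (transport_cost c \<pi>))"

definition entropic_OT_cost ::
    "real \<Rightarrow> ('a \<Rightarrow> 'b \<Rightarrow> real) \<Rightarrow> 'a measure \<Rightarrow> 'b measure \<Rightarrow> ereal" where
  "entropic_OT_cost \<epsilon> c \<alpha> \<beta> =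
     (INF \<pi>\<in>couplings \<alpha> \<beta>.
        ereal (transport_cost c \<pi>) + ereal \<epsilon> * relative_entropy \<pi> (\<alpha> \<Otimes>\<^sub>M \<beta>))"

end

theory Submission
  imports Defs "HOL-Real_Asymp.Real_Asymp"
begin

text \<open>
  The regularized cost dominates the unregularized one because relative entropy is nonnegative.

  For the upper bound, every coupling \<open>\<pi>\<close> is replaced by a nearby coupling of small entropy. Partition \<open>X\<close>
  into \<open>n ^ d\<close> cells of diameter at most \<open>sqrt d * D / n\<close>, and make the coordinates independent given the
  cell of the first one. The result (\<open>block\<close>) has the same marginals, and the pair of the cell of \<open>x\<close> and the
  point \<open>y\<close> keeps its law (\<open>nn_integral_block\<close>). Since the cost is Lipschitz in \<open>x\<close>, moving \<open>x\<close> to a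
  representative of its cell and back shows that the transport cost grows by at most
  \<open>2 * L * sqrt d * D / n\<close> (\<open>transport_cost_block\<close>). The relative entropy with respect to the product is the
  mutual information between the cell and \<open>y\<close>, which is at most the entropy of the cell, hence at most
  \<open>ln (n ^ d) = d * ln n\<close> (\<open>relative_entropy_block\<close>).

  With \<open>s = L * D / (sqrt d * \<epsilon>)\<close> the gap between the costs is thus at most \<open>\<epsilon> * d * (2 * s / n + ln n)\<close>, and
  \<open>n = \<lceil>s\<rceil>\<close> brings this below \<open>2 * \<epsilon> * d * (2 + ln s)\<close>, the claimed bound, as long as \<open>s \<ge> exp (-1)\<close>
  (\<open>grid_size_tradeoff\<close>).
\<close>

section \<open>Densities and relative entropy\<close>

text \<open>
  The Radon--Nikodym derivative of a measure dominated by \<open>M\<close> is at most 1 almost everywhere;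
  truncating it gives a version with these bounds at every point. Pointwise bounds spare the
  entropy estimate all exceptional null sets.
\<close>

lemma submeasure_has_density_le_1:
  assumes M: "finite_measure M" and sets_N: "sets N = sets M"
    and le: "\<And>A. A \<in> sets M \<Longrightarrow> emeasure N A \<le> emeasure M A"
  shows "\<exists>f. f \<in> borel_measurable M \<and> (\<forall>x. 0 \<le> f x \<and> f x \<le> (1::real)) \<and>
    density M (\<lambda>x. ennreal (f x)) = N"
proof -
  interpret finite_measure M by fact
  let ?D = "RN_deriv M N"
  have ac: "absolutely_continuous M N"
    unfolding absolutely_continuous_def
  proof
    fix A assume "A \<in> null_sets M"
    then show "A \<in> null_sets N"
      using le[of A] sets_N by (auto simp: null_sets_def)
  qed
  have N: "density M ?D = N"
    by (rule density_RN_deriv[OF ac sets_N])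
  define A where "A = {x \<in> space M. 1 < ?D x}"
  have [measurable]: "A \<in> sets M"
    by (simp add: A_def)
  have "(\<integral>\<^sup>+x. ?D x * indicator A x \<partial>M) \<le> (\<integral>\<^sup>+x. indicator A x \<partial>M)"
    using le[of A] arg_cong[OF N, of "\<lambda>M. emeasure M A"] by (simp add: emeasure_density)
  moreover have fin: "(\<integral>\<^sup>+x. indicator A x \<partial>M) \<noteq> \<infinity>"
    by (simp add: emeasure_finite)
  moreover have "(\<integral>\<^sup>+x. ?D x * indicator A x - indicator A x \<partial>M) =
      (\<integral>\<^sup>+x. ?D x * indicator A x \<partial>M) - (\<integral>\<^sup>+x. indicator A x \<partial>M)"
    by (rule nn_integral_diff) (use fin in \<open>auto simp: A_def split: split_indicator\<close>)
  moreover have "a - b = 0" if "a \<le> b" "b \<noteq> \<infinity>" for a b :: ennreal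
    using that by (metis diff_eq_0_iff_ennreal infinity_ennreal_def less_top order_le_less_trans)
  ultimately have "(\<integral>\<^sup>+x. ?D x * indicator A x - indicator A x \<partial>M) = 0"
    by metis
  then have "AE x in M. ?D x * indicator A x - indicator A x = 0"
    by (subst (asm) nn_integral_0_iff_AE) auto
  then have D_le: "AE x in M. ?D x \<le> 1"
    using AE_space
  proof eventually_elim
    case (elim x)
    show ?case
    proof (rule ccontr)
      assume "\<not> ?D x \<le> 1"
      then have "1 < ?D x" by simp
      with elim have "?D x - 1 = 0"
        by (simp add: A_def)
      with \<open>1 < ?D x\<close> show False
        by (metis diff_eq_0_iff_ennreal ennreal_one_neq_top leD)
    qed
  qed
  define f where "f x = min 1 (enn2real (?D x))" for x
  have [measurable]: "f \<in> borel_measurable M"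
    unfolding f_def by measurable
  have "AE x in M. ennreal (f x) = ?D x"
    using D_le
  proof eventually_elim
    case (elim x)
    then have "?D x < \<top>"
      by (meson ennreal_one_less_top order_le_less_trans)
    moreover have "enn2real (?D x) \<le> 1"
      using elim by (metis enn2real_mono enn2real_1 ennreal_one_less_top)
    ultimately show ?case
      by (simp add: f_def min_absorb2)
  qed
  then have "density M (\<lambda>x. ennreal (f x)) = density M ?D"
    by (intro density_cong) auto
  then show ?thesis
    by (intro exI[of _ f]) (auto simp: N f_def)
qed

text \<open>
  Where the relative entropy is not \<open>\<infinity>\<close> it is the integral of \<open>D ln D\<close> for a density \<open>D\<close>, and this
  is nonnegative by Gibbs' inequality.
\<close>

lemma relative_entropy_nonneg:
  assumes "prob_space \<mu>" "prob_space \<pi>" and sets_eq: "sets \<pi> = sets \<mu>"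
  shows "0 \<le> relative_entropy \<pi> \<mu>"
proof (cases "absolutely_continuous \<mu> \<pi> \<and> integrable \<pi> (entropy_density (exp 1) \<mu> \<pi>)")
  case True
  interpret M: prob_space \<mu> by fact
  interpret N: prob_space \<pi> by fact
  interpret information_space \<mu> "exp 1" by standard simp
  have ac: "absolutely_continuous \<mu> \<pi>"
    and int: "integrable \<pi> (entropy_density (exp 1) \<mu> \<pi>)"
    using True by auto
  obtain D where D: "D \<in> borel_measurable \<mu>" "AE x in \<mu>. RN_deriv \<mu> \<pi> x = ennreal (D x)"
      "AE x in \<pi>. 0 < D x" "\<And>x. 0 \<le> D x"
    using M.real_RN_deriv[OF N.finite_measure_axioms ac sets_eq] by blast
  note [measurable] = D(1)
  have "\<pi> = density \<mu> (RN_deriv \<mu> \<pi>)"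
    using ac sets_eq by (rule M.density_RN_deriv[symmetric])
  also have "\<dots> = density \<mu> D"
    using D by (auto intro!: density_cong)
  finally have N: "\<pi> = density \<mu> D" .
  from absolutely_continuous_AE[OF sets_eq ac D(2)]
  have "integrable \<pi> (\<lambda>x. log (exp 1) (D x))"
    using D measurable_entropy_density[of "exp 1" \<mu> \<pi>] sets_eq
    by (intro integrable_cong_AE[THEN iffD2, OF _ _ _ int])
       (auto simp: N entropy_density_def)
  with D have "integrable \<mu> (\<lambda>x. D x * log (exp 1) (D x))"
    by (subst integrable_real_density[symmetric]) (auto simp: N[symmetric] comp_def)
  then have "0 \<le> KL_divergence (exp 1) \<mu> (density \<mu> D)"
    using D N.prob_space_axioms by (intro KL_nonneg) (auto simp: N[symmetric])
  with True show ?thesis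
    by (simp add: relative_entropy_def N[symmetric])
qed (auto simp: relative_entropy_def)

text \<open>
  \<open>t ln t\<close> is bounded for \<open>0 \<le> t \<le> B\<close>: above by \<open>t\<^sup>2\<close>, and below because \<open>ln (1/t) \<le> 1/t\<close>. A bounded
  density therefore has finite relative entropy, given by the usual integral.
\<close>

lemma relative_entropy_bounded_density:
  fixes g :: "'a \<Rightarrow> real"
  assumes "prob_space \<mu>" and [measurable]: "g \<in> borel_measurable \<mu>"
    and g: "\<And>x. x \<in> space \<mu> \<Longrightarrow> 0 \<le> g x" "\<And>x. x \<in> space \<mu> \<Longrightarrow> g x \<le> B"
  shows "integrable \<mu> (\<lambda>x. g x * ln (g x))"
    and "relative_entropy (density \<mu> (\<lambda>x. ennreal (g x))) \<mu> = ereal (\<integral>x. g x * ln (g x) \<partial>\<mu>)"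
proof -
  interpret prob_space \<mu> by fact
  let ?N = "density \<mu> (\<lambda>x. ennreal (g x))"
  have bound: "\<bar>t * ln t\<bar> \<le> 1 + B * B" if "0 \<le> t" "t \<le> B" for t
  proof (cases "t = 0")
    case False
    with that have "0 < t" by simp
    have "t * ln t \<le> t * t"
      using \<open>0 < t\<close> ln_bound[of t] by (intro mult_left_mono) auto
    moreover have "t * t \<le> B * B"
      using that by (intro mult_mono) auto
    moreover have "- (t * ln t) = t * ln (1 / t)"
      using \<open>0 < t\<close> by (simp add: ln_div)
    moreover have "t * ln (1 / t) \<le> 1"
      using \<open>0 < t\<close> ln_bound[of "1 / t"] by (simp add: pos_le_divide_eq mult.commute)
    ultimately have "t * ln t \<le> 1 + B * B" "- (t * ln t) \<le> 1 + B * B"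
      using zero_le_square[of B] by linarith+
    then show ?thesis
      by (rule abs_leI)
  qed auto
  show int: "integrable \<mu> (\<lambda>x. g x * ln (g x))"
    using g bound by (intro integrable_const_bound[where B="1 + B * B"] AE_I2) auto
  have nn: "AE x in \<mu>. 0 \<le> g x"
    using g by (intro AE_I2) auto
  have log_exp: "log (exp 1) t = ln t" for t :: real
    by (simp add: log_def)
  have ac: "absolutely_continuous \<mu> ?N"
    by (rule absolutely_continuousI_density) measurable
  have "AE x in \<mu>. ennreal (g x) = RN_deriv \<mu> ?N x"
    by (rule RN_deriv_unique) auto
  then have "AE x in \<mu>. g x * entropy_density (exp 1) \<mu> ?N x = g x * ln (g x)"
    using nn by eventually_elim (simp add: entropy_density_def log_exp, metis enn2real_ennreal)
  then have "integrable \<mu> (\<lambda>x. g x * entropy_density (exp 1) \<mu> ?N x)"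
    by (intro integrable_cong_AE[THEN iffD2, OF _ _ _ int]) measurable
  then have "integrable ?N (entropy_density (exp 1) \<mu> ?N)"
    using nn by (subst integrable_real_density) auto
  moreover have "KL_divergence (exp 1) \<mu> ?N = (\<integral>x. g x * ln (g x) \<partial>\<mu>)"
    using nn by (subst KL_density) (auto simp: log_exp)
  ultimately show "relative_entropy ?N \<mu> = ereal (\<integral>x. g x * ln (g x) \<partial>\<mu>)"
    using ac by (simp add: relative_entropy_def)
qed

section \<open>Block approximation of a coupling\<close>

text \<open>
  A coupling together with a finite labelling \<open>I\<close> of the first factor. The labels are the cells of a
  partition of the first space; only the label of a point will be remembered.
\<close>

locale coarsened_coupling =
  fixes \<alpha> :: "'a measure" and \<beta> :: "'b measure" and \<pi> :: "('a \<times> 'b) measure"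
    and I :: "'a \<Rightarrow> 'i" and J :: "'i set"
  assumes prob_\<alpha>: "prob_space \<alpha>" and prob_\<beta>: "prob_space \<beta>"
    and coupling: "\<pi> \<in> couplings \<alpha> \<beta>"
    and finite_J: "finite J"
    and I_measurable [measurable]: "I \<in> measurable \<alpha> (count_space J)"
begin

sublocale \<alpha>: prob_space \<alpha> by (rule prob_\<alpha>)
sublocale \<beta>: prob_space \<beta> by (rule prob_\<beta>)
sublocale \<alpha>\<beta>: pair_prob_space \<alpha> \<beta> ..
sublocale \<pi>: prob_space \<pi> using coupling by (simp add: couplings_def)

lemma sets_\<pi> [measurable_cong]: "sets \<pi> = sets (\<alpha> \<Otimes>\<^sub>M \<beta>)"
  using coupling by (simp add: couplings_def)

lemma space_\<pi>: "space \<pi> = space \<alpha> \<times> space \<beta>"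
  using sets_eq_imp_space_eq[OF sets_\<pi>] by (simp add: space_pair_measure)

lemma nn_integral_fst_\<pi>:
  assumes [measurable]: "u \<in> borel_measurable \<alpha>"
  shows "(\<integral>\<^sup>+p. u (fst p) \<partial>\<pi>) = (\<integral>\<^sup>+x. u x \<partial>\<alpha>)"
proof -
  have "(\<integral>\<^sup>+x. u x \<partial>\<alpha>) = (\<integral>\<^sup>+x. u x \<partial>distr \<pi> \<alpha> fst)"
    using coupling by (simp add: couplings_def)
  also have "\<dots> = (\<integral>\<^sup>+p. u (fst p) \<partial>\<pi>)"
    by (subst nn_integral_distr) auto
  finally show ?thesis ..
qed

lemma nn_integral_snd_\<pi>:
  assumes [measurable]: "u \<in> borel_measurable \<beta>"
  shows "(\<integral>\<^sup>+p. u (snd p) \<partial>\<pi>) = (\<integral>\<^sup>+y. u y \<partial>\<beta>)"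
proof -
  have "(\<integral>\<^sup>+y. u y \<partial>\<beta>) = (\<integral>\<^sup>+y. u y \<partial>distr \<pi> \<beta> snd)"
    using coupling by (simp add: couplings_def)
  also have "\<dots> = (\<integral>\<^sup>+p. u (snd p) \<partial>\<pi>)"
    by (subst nn_integral_distr) auto
  finally show ?thesis ..
qed

definition cell :: "'i \<Rightarrow> 'a set" where
  "cell i = I -` {i} \<inter> space \<alpha>"

definition mass :: "'i \<Rightarrow> real" where
  "mass i = measure \<alpha> (cell i)"

lemma sets_cell [measurable]: "i \<in> J \<Longrightarrow> cell i \<in> sets \<alpha>"
  unfolding cell_def by (rule measurable_sets[OF I_measurable]) auto

lemma emeasure_cell: "emeasure \<alpha> (cell i) = ennreal (mass i)"
  by (simp add: mass_def \<alpha>.emeasure_eq_measure)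

lemma mass_nonneg: "0 \<le> mass i"
  by (simp add: mass_def)

lemma I_in_J: "x \<in> space \<alpha> \<Longrightarrow> I x \<in> J"
  using measurable_space[OF I_measurable] by simp

text \<open>
  The division by \<open>mass (I x)\<close> in the block density below has value 0 on cells of mass 0. There are
  finitely many such cells, so together they are negligible.
\<close>

lemma AE_mass_pos: "AE x in \<alpha>. 0 < mass (I x)"
proof -
  have "AE x in \<alpha>. \<forall>i\<in>J. mass i = 0 \<longrightarrow> x \<notin> cell i"
  proof (rule AE_finite_allI[OF finite_J])
    fix i assume "i \<in> J"
    show "AE x in \<alpha>. mass i = 0 \<longrightarrow> x \<notin> cell i"
    proof (cases "mass i = 0")
      case True
      then have "cell i \<in> null_sets \<alpha>"
        using \<open>i \<in> J\<close> emeasure_cell[of i] by (intro null_setsI) auto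
      then show ?thesis
        using AE_not_in by auto
    qed simp
  qed
  then show ?thesis
    using AE_space
  proof eventually_elim
    case (elim x)
    then have "x \<in> cell (I x)"
      by (simp add: cell_def)
    with elim I_in_J[of x] mass_nonneg[of "I x"] show ?case
      by fastforce
  qed
qed

text \<open>
  Exactly one summand survives. This turns integrals of functions that see \<open>x\<close> only through its label
  into finite sums.
\<close>

lemma sum_over_cells:
  fixes v :: "'i \<Rightarrow> ennreal"
  assumes "x \<in> space \<alpha>"
  shows "v (I x) = (\<Sum>i\<in>J. indicator (cell i) x * v i)"
proof -
  have "(\<Sum>i\<in>J. indicator (cell i) x * v i) = (\<Sum>i\<in>J. if i = I x then v i else 0)"
    using assms by (intro sum.cong) (auto simp: cell_def indicator_def)
  then show ?thesis
    using I_in_J[OF assms] finite_J by simp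
qed

text \<open>
  The second marginal of the part of \<open>\<pi>\<close> that lies over the cell \<open>i\<close>. The slices add up to \<open>\<beta>\<close>, so each
  is dominated by \<open>\<beta>\<close>.
\<close>

definition slice :: "'i \<Rightarrow> 'b measure" where
  "slice i = distr (density \<pi> (\<lambda>p. indicator (cell i) (fst p))) \<beta> snd"

lemma sets_slice [measurable_cong]: "sets (slice i) = sets \<beta>"
  by (simp add: slice_def)

lemma nn_integral_slice:
  assumes [simp]: "i \<in> J" and [measurable]: "u \<in> borel_measurable \<beta>"
  shows "(\<integral>\<^sup>+y. u y \<partial>slice i) = (\<integral>\<^sup>+p. indicator (cell i) (fst p) * u (snd p) \<partial>\<pi>)"
  unfolding slice_def
  by (subst nn_integral_distr, simp_all, subst nn_integral_density) (auto intro!: borel_measurable_indicator')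

lemma ex_slice_density:
  assumes "i \<in> J"
  shows "\<exists>f. f \<in> borel_measurable \<beta> \<and> (\<forall>y. 0 \<le> f y \<and> f y \<le> (1::real)) \<and>
    density \<beta> (\<lambda>y. ennreal (f y)) = slice i"
proof (rule submeasure_has_density_le_1[OF \<beta>.finite_measure_axioms sets_slice])
  fix B assume [measurable]: "B \<in> sets \<beta>"
  have "emeasure (slice i) B = (\<integral>\<^sup>+y. indicator B y \<partial>slice i)"
    by (simp add: sets_slice)
  also have "\<dots> = (\<integral>\<^sup>+p. indicator (cell i) (fst p) * indicator B (snd p) \<partial>\<pi>)"
    using assms by (intro nn_integral_slice) auto
  also have "\<dots> \<le> (\<integral>\<^sup>+p. indicator B (snd p) \<partial>\<pi>)"
    by (intro nn_integral_mono) (auto split: split_indicator)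
  also have "\<dots> = emeasure \<beta> B"
    by (subst nn_integral_snd_\<pi>) auto
  finally show "emeasure (slice i) B \<le> emeasure \<beta> B" .
qed

definition slice_density :: "'i \<Rightarrow> 'b \<Rightarrow> real" where
  "slice_density i = (SOME f. f \<in> borel_measurable \<beta> \<and> (\<forall>y. 0 \<le> f y \<and> f y \<le> 1) \<and>
    density \<beta> (\<lambda>y. ennreal (f y)) = slice i)"

lemma
  assumes "i \<in> J"
  shows measurable_slice_density [measurable]: "slice_density i \<in> borel_measurable \<beta>"
    and slice_density_nonneg: "0 \<le> slice_density i y"
    and slice_density_le_1: "slice_density i y \<le> 1"
    and density_slice_density: "density \<beta> (\<lambda>y. ennreal (slice_density i y)) = slice i"
  using someI_ex[OF ex_slice_density[OF assms]] unfolding slice_density_def by blast+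

lemma nn_integral_slice_density:
  assumes [simp]: "i \<in> J" and [measurable]: "u \<in> borel_measurable \<beta>"
  shows "(\<integral>\<^sup>+y. ennreal (slice_density i y) * u y \<partial>\<beta>) =
    (\<integral>\<^sup>+p. indicator (cell i) (fst p) * u (snd p) \<partial>\<pi>)"
  by (subst nn_integral_slice[symmetric], simp, simp, subst density_slice_density[symmetric])
     (auto simp: nn_integral_density)

lemma nn_integral_slice_density_1:
  assumes [simp]: "i \<in> J"
  shows "(\<integral>\<^sup>+y. ennreal (slice_density i y) \<partial>\<beta>) = ennreal (mass i)"
  using nn_integral_slice_density[of i "\<lambda>_. 1"] nn_integral_fst_\<pi>[of "indicator (cell i)"]
  by (simp add: emeasure_cell)

text \<open>
  Under \<open>block\<close>, given the label \<open>i\<close>, the two coordinates are independent: \<open>x\<close> follows \<open>\<alpha>\<close> conditioned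
  on cell \<open>i\<close>, and \<open>y\<close> follows the normalised slice. The label and \<open>y\<close> keep the joint law that they have
  under \<open>\<pi>\<close>.
\<close>

definition block_density :: "'a \<times> 'b \<Rightarrow> real" where
  "block_density p = slice_density (I (fst p)) (snd p) / mass (I (fst p))"

definition block :: "('a \<times> 'b) measure" where
  "block = density (\<alpha> \<Otimes>\<^sub>M \<beta>) (\<lambda>p. ennreal (block_density p))"

lemma sets_block [measurable_cong]: "sets block = sets (\<alpha> \<Otimes>\<^sub>M \<beta>)"
  by (simp add: block_def)

lemma measurable_cellwise:
  assumes "\<And>i. i \<in> J \<Longrightarrow> u i \<in> measurable \<beta> M"
  shows "(\<lambda>p. u (I (fst p)) (snd p)) \<in> measurable (\<alpha> \<Otimes>\<^sub>M \<beta>) M"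
proof -
  have "(\<lambda>q. u (fst q) (snd q)) \<in> measurable (count_space J \<Otimes>\<^sub>M \<beta>) M"
    using assms finite_J by (intro measurable_pair_measure_countable1 countable_finite) auto
  then have "(\<lambda>p. u (fst (I (fst p), snd p)) (snd (I (fst p), snd p))) \<in> measurable (\<alpha> \<Otimes>\<^sub>M \<beta>) M"
    by (rule measurable_compose[rotated]) measurable
  then show ?thesis
    by simp
qed

lemma measurable_block_density [measurable]: "block_density \<in> borel_measurable (\<alpha> \<Otimes>\<^sub>M \<beta>)"
  unfolding block_density_def
  by (rule measurable_cellwise[of "\<lambda>i y. slice_density i y / mass i"]) measurable

text \<open>
  Nothing changes for functions of \<open>(I x, y)\<close>: the integral splits into cells, and on cell \<open>i\<close> the factor
  \<open>1 / mass i\<close> in the density cancels against the mass of the cell. A cell of mass 0 contributes 0 under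
  \<open>\<pi>\<close> as well, since \<open>\<pi>\<close> has first marginal \<open>\<alpha>\<close>.
\<close>

lemma nn_integral_block:
  assumes u: "\<And>i. i \<in> J \<Longrightarrow> u i \<in> borel_measurable \<beta>"
  shows "(\<integral>\<^sup>+p. u (I (fst p)) (snd p) \<partial>block) = (\<integral>\<^sup>+p. u (I (fst p)) (snd p) \<partial>\<pi>)"
proof -
  note [measurable] = u
  have [measurable]: "(\<lambda>p. u (I (fst p)) (snd p)) \<in> borel_measurable (\<alpha> \<Otimes>\<^sub>M \<beta>)"
    by (rule measurable_cellwise[OF u])
  let ?w = "\<lambda>i y. ennreal (slice_density i y / mass i) * u i y"
  have "(\<integral>\<^sup>+p. u (I (fst p)) (snd p) \<partial>block) =
      (\<integral>\<^sup>+p. ?w (I (fst p)) (snd p) \<partial>(\<alpha> \<Otimes>\<^sub>M \<beta>))"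
    unfolding block_def by (subst nn_integral_density) (auto simp flip: block_density_def)
  also have "\<dots> = (\<integral>\<^sup>+p. (\<Sum>i\<in>J. indicator (cell i) (fst p) * ?w i (snd p)) \<partial>(\<alpha> \<Otimes>\<^sub>M \<beta>))"
  proof (intro nn_integral_cong)
    fix p assume "p \<in> space (\<alpha> \<Otimes>\<^sub>M \<beta>)"
    then have "fst p \<in> space \<alpha>" by (auto simp: space_pair_measure)
    from sum_over_cells[OF this, of "\<lambda>i. ?w i (snd p)"]
    show "?w (I (fst p)) (snd p) = (\<Sum>i\<in>J. indicator (cell i) (fst p) * ?w i (snd p))" .
  qed
  also have "\<dots> = (\<Sum>i\<in>J. \<integral>\<^sup>+p. indicator (cell i) (fst p) * ?w i (snd p) \<partial>(\<alpha> \<Otimes>\<^sub>M \<beta>))"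
    by (intro nn_integral_sum) auto
  also have "\<dots> = (\<Sum>i\<in>J. \<integral>\<^sup>+p. indicator (cell i) (fst p) * u i (snd p) \<partial>\<pi>)"
  proof (intro sum.cong refl)
    fix i assume [simp]: "i \<in> J"
    have "(\<integral>\<^sup>+p. indicator (cell i) (fst p) * ?w i (snd p) \<partial>(\<alpha> \<Otimes>\<^sub>M \<beta>)) =
        (\<integral>\<^sup>+x. \<integral>\<^sup>+y. indicator (cell i) x * ?w i y \<partial>\<beta> \<partial>\<alpha>)"
      by (subst \<beta>.nn_integral_fst[symmetric]) auto
    also have "\<dots> = (\<integral>\<^sup>+x. indicator (cell i) x * (\<integral>\<^sup>+y. ?w i y \<partial>\<beta>) \<partial>\<alpha>)"
      by (intro nn_integral_cong nn_integral_cmult) auto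
    also have "\<dots> = ennreal (mass i) * (\<integral>\<^sup>+y. ?w i y \<partial>\<beta>)"
      by (subst nn_integral_multc) (auto simp: emeasure_cell)
    also have "\<dots> = (\<integral>\<^sup>+p. indicator (cell i) (fst p) * u i (snd p) \<partial>\<pi>)"
    proof (cases "mass i = 0")
      case True
      have "(\<integral>\<^sup>+p. indicator (cell i) (fst p) \<partial>\<pi>) = 0"
        using True by (subst nn_integral_fst_\<pi>) (auto simp: emeasure_cell)
      then have "AE p in \<pi>. indicator (cell i) (fst p) = (0::ennreal)"
        by (subst (asm) nn_integral_0_iff_AE) auto
      then have "(\<integral>\<^sup>+p. indicator (cell i) (fst p) * u i (snd p) \<partial>\<pi>) = (\<integral>\<^sup>+p. 0 \<partial>\<pi>)"
        by (intro nn_integral_cong_AE) auto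
      with True show ?thesis
        by simp
    next
      case False
      then have pos: "0 < mass i"
        using mass_nonneg[of i] by simp
      have "ennreal (mass i) * (\<integral>\<^sup>+y. ?w i y \<partial>\<beta>) = (\<integral>\<^sup>+y. ennreal (mass i) * ?w i y \<partial>\<beta>)"
        by (intro nn_integral_cmult[symmetric]) auto
      also have "\<dots> = (\<integral>\<^sup>+y. ennreal (slice_density i y) * u i y \<partial>\<beta>)"
        using pos slice_density_nonneg[of i]
        by (intro nn_integral_cong) (simp add: mult.assoc[symmetric] ennreal_mult[symmetric])
      also have "\<dots> = (\<integral>\<^sup>+p. indicator (cell i) (fst p) * u i (snd p) \<partial>\<pi>)"
        by (intro nn_integral_slice_density) auto
      finally show ?thesis .
    qed
    finally show "(\<integral>\<^sup>+p. indicator (cell i) (fst p) * ?w i (snd p) \<partial>(\<alpha> \<Otimes>\<^sub>M \<beta>)) =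
      (\<integral>\<^sup>+p. indicator (cell i) (fst p) * u i (snd p) \<partial>\<pi>)" .
  qed
  also have "\<dots> = (\<integral>\<^sup>+p. (\<Sum>i\<in>J. indicator (cell i) (fst p) * u i (snd p)) \<partial>\<pi>)"
    by (intro nn_integral_sum[symmetric]) auto
  also have "\<dots> = (\<integral>\<^sup>+p. u (I (fst p)) (snd p) \<partial>\<pi>)"
  proof (intro nn_integral_cong)
    fix p assume "p \<in> space \<pi>"
    then have "fst p \<in> space \<alpha>" by (auto simp: space_\<pi>)
    from sum_over_cells[OF this, of "\<lambda>i. u i (snd p)"]
    show "(\<Sum>i\<in>J. indicator (cell i) (fst p) * u i (snd p)) = u (I (fst p)) (snd p)" ..
  qed
  finally show ?thesis .
qed

lemma prob_space_block: "prob_space block"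
proof
  have "emeasure block (space block) = (\<integral>\<^sup>+p. 1 \<partial>block)"
    by simp
  also have "\<dots> = (\<integral>\<^sup>+p. 1 \<partial>\<pi>)"
    by (rule nn_integral_block[of "\<lambda>_ _. 1"]) simp
  finally show "emeasure block (space block) = 1"
    by (simp add: \<pi>.emeasure_space_1)
qed

text \<open>
  Integrating the block density over \<open>y\<close> gives the mass of the slice over the mass of the cell, and the
  two are equal.
\<close>

lemma distr_block_fst: "distr block \<alpha> fst = \<alpha>"
proof (rule measure_eqI)
  fix A assume "A \<in> sets (distr block \<alpha> fst)"
  then have [measurable]: "A \<in> sets \<alpha>" by simp
  have [measurable]: "(\<lambda>p. ennreal (block_density p) * indicator A (fst p)) \<in> borel_measurable (\<alpha> \<Otimes>\<^sub>M \<beta>)"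
    by measurable
  have "emeasure (distr block \<alpha> fst) A = (\<integral>\<^sup>+x. indicator A x \<partial>distr block \<alpha> fst)"
    by simp
  also have "\<dots> = (\<integral>\<^sup>+p. indicator A (fst p) \<partial>block)"
    by (subst nn_integral_distr) auto
  also have "\<dots> = (\<integral>\<^sup>+p. ennreal (block_density p) * indicator A (fst p) \<partial>(\<alpha> \<Otimes>\<^sub>M \<beta>))"
    unfolding block_def by (subst nn_integral_density) auto
  also have "\<dots> = (\<integral>\<^sup>+x. \<integral>\<^sup>+y. ennreal (block_density (x, y)) * indicator A x \<partial>\<beta> \<partial>\<alpha>)"
    by (subst \<beta>.nn_integral_fst[symmetric]) auto
  also have "\<dots> = (\<integral>\<^sup>+x. indicator A x \<partial>\<alpha>)"
  proof (rule nn_integral_cong_AE)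
    show "AE x in \<alpha>. (\<integral>\<^sup>+y. ennreal (block_density (x, y)) * indicator A x \<partial>\<beta>) = indicator A x"
      using AE_mass_pos AE_space
    proof eventually_elim
      case (elim x)
      note [simp] = I_in_J[OF elim(2)]
      have "(\<integral>\<^sup>+y. ennreal (block_density (x, y)) * indicator A x \<partial>\<beta>) =
          (\<integral>\<^sup>+y. ennreal (slice_density (I x) y) * (ennreal (1 / mass (I x)) * indicator A x) \<partial>\<beta>)"
        using elim(1) slice_density_nonneg[of "I x"]
        by (intro nn_integral_cong)
           (simp add: block_density_def mult.assoc[symmetric] ennreal_mult[symmetric])
      also have "\<dots> = ennreal (mass (I x)) * (ennreal (1 / mass (I x)) * indicator A x)"
        by (subst nn_integral_multc) (auto simp: nn_integral_slice_density_1)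
      also have "\<dots> = indicator A x"
        using elim(1) by (simp add: mult.assoc[symmetric] ennreal_mult[symmetric])
      finally show ?case .
    qed
  qed
  finally show "emeasure (distr block \<alpha> fst) A = emeasure \<alpha> A"
    by simp
qed simp

lemma distr_block_snd: "distr block \<beta> snd = \<beta>"
proof (rule measure_eqI)
  fix B assume "B \<in> sets (distr block \<beta> snd)"
  then have [measurable]: "B \<in> sets \<beta>" by simp
  have "emeasure (distr block \<beta> snd) B = (\<integral>\<^sup>+y. indicator B y \<partial>distr block \<beta> snd)"
    by simp
  also have "\<dots> = (\<integral>\<^sup>+p. indicator B (snd p) \<partial>block)"
    by (subst nn_integral_distr) auto
  also have "\<dots> = (\<integral>\<^sup>+p. indicator B (snd p) \<partial>\<pi>)"
    by (rule nn_integral_block) simp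
  also have "\<dots> = emeasure \<beta> B"
    by (subst nn_integral_snd_\<pi>) auto
  finally show "emeasure (distr block \<beta> snd) B = emeasure \<beta> B" .
qed simp

lemma block_in_couplings: "block \<in> couplings \<alpha> \<beta>"
  by (simp add: couplings_def prob_space_block sets_block distr_block_fst distr_block_snd)

text \<open>
  The form of \<open>nn_integral_block\<close> that transfers Bochner integrals of functions of either sign.
\<close>

lemma distr_block_coarse:
  "distr block (count_space J \<Otimes>\<^sub>M \<beta>) (\<lambda>p. (I (fst p), snd p)) =
   distr \<pi> (count_space J \<Otimes>\<^sub>M \<beta>) (\<lambda>p. (I (fst p), snd p))" (is "distr _ ?K ?T = _")
proof (rule measure_eqI)
  fix A assume "A \<in> sets (distr block ?K ?T)"
  then have [measurable]: "A \<in> sets ?K" by simp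
  have ind: "indicator A (i, y) = indicator (Pair i -` A) y" for i :: 'i and y
    by (simp add: indicator_def)
  have [measurable]: "?T \<in> measurable block ?K" "?T \<in> measurable \<pi> ?K"
    by measurable
  have "emeasure (distr block ?K ?T) A = (\<integral>\<^sup>+q. indicator A q \<partial>distr block ?K ?T)"
    by simp
  also have "\<dots> = (\<integral>\<^sup>+p. indicator A (?T p) \<partial>block)"
    by (subst nn_integral_distr) auto
  also have "\<dots> = (\<integral>\<^sup>+p. indicator A (?T p) \<partial>\<pi>)"
    by (rule nn_integral_block[of "\<lambda>i y. indicator A (i, y)"]) auto
  also have "\<dots> = (\<integral>\<^sup>+q. indicator A q \<partial>distr \<pi> ?K ?T)"
    by (subst nn_integral_distr) auto
  finally show "emeasure (distr block ?K ?T) A = emeasure (distr \<pi> ?K ?T) A"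
    by simp
qed simp

lemma J_nonempty: "J \<noteq> {}"
  using I_in_J \<alpha>.not_empty by blast

lemma block_density_nonneg: "p \<in> space (\<alpha> \<Otimes>\<^sub>M \<beta>) \<Longrightarrow> 0 \<le> block_density p"
  using I_in_J[of "fst p"] mass_nonneg slice_density_nonneg
  by (auto simp: block_density_def space_pair_measure)

lemma block_density_le: "p \<in> space (\<alpha> \<Otimes>\<^sub>M \<beta>) \<Longrightarrow> block_density p \<le> 1 / mass (I (fst p))"
  using I_in_J[of "fst p"] mass_nonneg slice_density_le_1
  by (auto simp: block_density_def space_pair_measure intro!: divide_right_mono)

text \<open>
  With \<open>n\<close> cells, slice densities at most 1 give \<open>g \<le> 1 / mass (I x)\<close> for the block density \<open>g\<close>. The
  relative entropy is hence at most the Shannon entropy of the masses of the cells, which is largest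
  when they are all \<open>1 / n\<close>. The comparison with \<open>ln n\<close> uses \<open>ln t \<le> t - 1\<close> pointwise, with
  \<open>t = 1 / (n * mass (I x))\<close>, whose integral is at most 1.
\<close>

lemma relative_entropy_block: "relative_entropy block (\<alpha> \<Otimes>\<^sub>M \<beta>) \<le> ereal (ln (card J))"
proof -
  let ?\<mu> = "\<alpha> \<Otimes>\<^sub>M \<beta>" and ?g = block_density
  interpret block: prob_space block by (rule prob_space_block)
  define n where "n = real (card J)"
  have n: "0 < n"
    using J_nonempty finite_J by (simp add: n_def card_gt_0_iff)
  \<comment> \<open>the density of the uniform distribution on labels relative to the law of the label; a label of
    mass 0 gets the value 0, so the integral may fall below 1\<close>
  define r where "r i = 1 / (n * mass i)" for i
  have r_nonneg: "0 \<le> r i" for i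
    using n mass_nonneg by (simp add: r_def)
  have g_le: "?g p \<le> (\<Sum>i\<in>J. 1 / mass i)" if "p \<in> space ?\<mu>" for p
  proof -
    have "1 / mass (I (fst p)) \<le> (\<Sum>i\<in>J. 1 / mass i)"
      using that finite_J mass_nonneg I_in_J[of "fst p"]
      by (intro member_le_sum) (auto simp: space_pair_measure)
    with block_density_le[OF that] show ?thesis by simp
  qed
  note ent = relative_entropy_bounded_density[OF \<alpha>\<beta>.prob_space_axioms measurable_block_density
      block_density_nonneg g_le]
  have [measurable]: "(\<lambda>p. r (I (fst p))) \<in> borel_measurable ?\<mu>"
    by (rule measurable_cellwise) simp
  have "(\<integral>\<^sup>+p. ennreal (r (I (fst p))) \<partial>block) = (\<integral>\<^sup>+p. ennreal (r (I (fst p))) \<partial>\<pi>)"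
    by (rule nn_integral_block) simp
  also have "\<dots> = (\<integral>\<^sup>+x. ennreal (r (I x)) \<partial>\<alpha>)"
    by (rule nn_integral_fst_\<pi>) (rule measurable_compose[OF I_measurable], simp)
  also have "\<dots> = (\<integral>\<^sup>+x. (\<Sum>i\<in>J. indicator (cell i) x * ennreal (r i)) \<partial>\<alpha>)"
    by (intro nn_integral_cong sum_over_cells)
  also have "\<dots> = (\<Sum>i\<in>J. \<integral>\<^sup>+x. indicator (cell i) x * ennreal (r i) \<partial>\<alpha>)"
    by (intro nn_integral_sum) auto
  also have "\<dots> = (\<Sum>i\<in>J. ennreal (mass i * r i))"
    using mass_nonneg r_nonneg
    by (intro sum.cong refl, subst nn_integral_multc) (auto simp: emeasure_cell ennreal_mult)
  also have "\<dots> \<le> (\<Sum>i\<in>J. ennreal (1 / n))"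
    using n by (intro sum_mono ennreal_leI) (auto simp: r_def divide_simps)
  also have "\<dots> = ennreal (\<Sum>i\<in>J. 1 / n)"
    using n by (subst sum_ennreal) auto
  also have "\<dots> = 1"
    using n by (simp add: n_def)
  finally have nn: "(\<integral>\<^sup>+p. ennreal (r (I (fst p))) \<partial>block) \<le> 1" .
  have meas_block: "borel_measurable block = borel_measurable ?\<mu>"
    by (rule measurable_cong_sets[OF sets_block refl])
  have int_r: "integrable block (\<lambda>p. r (I (fst p)))"
    using nn r_nonneg by (intro integrableI_nonneg) (auto simp: meas_block intro: order_le_less_trans)
  have int_r_le: "(\<integral>p. r (I (fst p)) \<partial>block) \<le> 1"
    using nn r_nonneg int_r by (subst (asm) nn_integral_eq_integral) auto
  have g_AE: "AE p in ?\<mu>. 0 \<le> ?g p"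
    using block_density_nonneg by (intro AE_I2)
  let ?h = "\<lambda>p. (ln n - 1) + r (I (fst p))"
  have int_h: "integrable block ?h"
    using int_r by simp
  have "(\<integral>p. ?g p * ln (?g p) \<partial>?\<mu>) \<le> (\<integral>p. ?g p * ?h p \<partial>?\<mu>)"
  proof (rule integral_mono)
    show "integrable ?\<mu> (\<lambda>p. ?g p * ln (?g p))"
      by (rule ent(1))
    show "integrable ?\<mu> (\<lambda>p. ?g p * ?h p)"
      using int_h g_AE unfolding block_def by (subst (asm) integrable_real_density) auto
    fix p assume p: "p \<in> space ?\<mu>"
    show "?g p * ln (?g p) \<le> ?g p * ?h p"
    proof (cases "?g p = 0")
      case False
      let ?a = "mass (I (fst p))"
      have pos: "0 < ?g p" "0 < ?a"
        using False block_density_nonneg[OF p] mass_nonneg[of "I (fst p)"]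
        by (auto simp: block_density_def less_le)
      have "ln (?g p) \<le> ln (1 / ?a)"
        using pos block_density_le[OF p] by (subst ln_le_cancel_iff) auto
      also have "\<dots> = ln n + ln (1 / (n * ?a))"
        using pos n by (simp add: ln_div ln_mult)
      also have "\<dots> \<le> ?h p"
        using ln_le_minus_one[of "1 / (n * ?a)"] pos n by (simp add: r_def)
      finally show ?thesis
        using pos by (intro mult_left_mono) auto
    qed simp
  qed
  also have "\<dots> = (\<integral>p. ?h p \<partial>block)"
    unfolding block_def using g_AE by (subst integral_real_density) auto
  also have "\<dots> = (ln n - 1) + (\<integral>p. r (I (fst p)) \<partial>block)"
    using int_r by (simp add: block.prob_space)
  also have "\<dots> \<le> ln n"
    using int_r_le by simp
  finally show ?thesis
    using ent(2) by (simp add: block_def n_def)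
qed

text \<open>
  Replacing \<open>x\<close> by a fixed representative of its cell costs at most \<open>\<eta>\<close>, once under \<open>block\<close> and once under
  \<open>\<pi>\<close>. The replaced cost depends on \<open>(I x, y)\<close> only, and therefore has the same integral under both.
\<close>

lemma transport_cost_block:
  assumes c [measurable]: "(\<lambda>p. c (fst p) (snd p)) \<in> borel_measurable (\<alpha> \<Otimes>\<^sub>M \<beta>)"
    and bounded: "\<And>x y. x \<in> space \<alpha> \<Longrightarrow> y \<in> space \<beta> \<Longrightarrow> \<bar>c x y\<bar> \<le> B"
    and osc: "\<And>x x' y. x \<in> space \<alpha> \<Longrightarrow> x' \<in> space \<alpha> \<Longrightarrow> y \<in> space \<beta> \<Longrightarrow> I x = I x' \<Longrightarrow>
      c x y \<le> c x' y + \<eta>"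
  shows "transport_cost c block \<le> transport_cost c \<pi> + 2 * \<eta>"
proof -
  interpret block: prob_space block by (rule prob_space_block)
  \<comment> \<open>labels of empty cells get an arbitrary point of the space, so that \<open>c (rep i)\<close> is measurable for
    every label\<close>
  define rep where "rep i =
    (if i \<in> I ` space \<alpha> then inv_into (space \<alpha>) I i else (SOME x. x \<in> space \<alpha>))" for i
  have rep: "rep i \<in> space \<alpha>" for i
    using \<alpha>.not_empty by (auto simp: rep_def inv_into_into some_in_eq)
  have I_rep: "I (rep (I x)) = I x" if "x \<in> space \<alpha>" for x
    using that by (auto simp: rep_def f_inv_into_f)
  let ?K = "count_space J \<Otimes>\<^sub>M \<beta>" and ?T = "\<lambda>p. (I (fst p), snd p)"
  let ?C = "\<lambda>p. c (fst p) (snd p)" and ?C' = "\<lambda>p. c (rep (I (fst p))) (snd p)"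
  have c_rep: "c (rep i) \<in> borel_measurable \<beta>" for i
    using measurable_compose[OF measurable_Pair1'[OF rep] c] by simp
  have C'_meas [measurable]: "?C' \<in> borel_measurable (\<alpha> \<Otimes>\<^sub>M \<beta>)"
    by (rule measurable_cellwise[of "\<lambda>i. c (rep i)"]) (rule c_rep)
  have K_meas: "(\<lambda>q. c (rep (fst q)) (snd q)) \<in> borel_measurable ?K"
    using c_rep finite_J by (intro measurable_pair_measure_countable1 countable_finite) auto
  have integ: "integrable M ?C" "integrable M ?C'"
    if "prob_space M" and sets_M: "sets M = sets (\<alpha> \<Otimes>\<^sub>M \<beta>)" for M
  proof -
    interpret prob_space M by fact
    have sp: "space M = space \<alpha> \<times> space \<beta>"
      using sets_eq_imp_space_eq[OF sets_M] by (simp add: space_pair_measure)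
    have M: "borel_measurable M = borel_measurable (\<alpha> \<Otimes>\<^sub>M \<beta>)"
      by (rule measurable_cong_sets[OF sets_M refl])
    show "integrable M ?C" "integrable M ?C'"
      using bounded rep by (auto intro!: integrable_const_bound[where B=B] simp: M sp)
  qed
  note int_block = integ[OF prob_space_block sets_block]
    and int_\<pi> = integ[OF \<pi>.prob_space_axioms sets_\<pi>]
  have sp_block: "space block = space \<alpha> \<times> space \<beta>"
    by (simp add: block_def space_pair_measure)
  have "transport_cost c block \<le> (\<integral>p. ?C' p + \<eta> \<partial>block)"
    unfolding transport_cost_def
    using int_block rep I_rep osc by (intro integral_mono) (auto simp: sp_block)
  also have "\<dots> = (\<integral>p. ?C' p \<partial>block) + \<eta>"
    using int_block by (simp add: block.prob_space)
  also have "(\<integral>p. ?C' p \<partial>block) = (\<integral>q. c (rep (fst q)) (snd q) \<partial>distr block ?K ?T)"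
    by (subst integral_distr[OF _ K_meas]) auto
  also have "\<dots> = (\<integral>q. c (rep (fst q)) (snd q) \<partial>distr \<pi> ?K ?T)"
    by (simp only: distr_block_coarse)
  also have "\<dots> = (\<integral>p. ?C' p \<partial>\<pi>)"
    by (subst integral_distr[OF _ K_meas]) auto
  also have "(\<integral>p. ?C' p \<partial>\<pi>) \<le> (\<integral>p. ?C p + \<eta> \<partial>\<pi>)"
    using int_\<pi> rep I_rep osc by (intro integral_mono) (auto simp: space_\<pi>)
  also have "\<dots> = transport_cost c \<pi> + \<eta>"
    unfolding transport_cost_def using int_\<pi> by (simp add: \<pi>.prob_space)
  finally show ?thesis by simp
qed

end

section \<open>Comparing the two transport costs\<close>

lemma ereal_INF_le_INF_plus_const:
  fixes f g :: "'a \<Rightarrow> ereal"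
  assumes "\<And>a. a \<in> A \<Longrightarrow> \<exists>b\<in>A. f b \<le> g a + ereal K"
  shows "(INF a\<in>A. f a) \<le> (INF a\<in>A. g a) + ereal K"
proof -
  have "(INF a\<in>A. f a) - ereal K \<le> (INF a\<in>A. g a)"
  proof (rule INF_greatest)
    fix a assume "a \<in> A"
    with assms obtain b where "b \<in> A" "f b \<le> g a + ereal K" by blast
    then have "(INF a\<in>A. f a) \<le> g a + ereal K"
      by (meson INF_lower2)
    then show "(INF a\<in>A. f a) - ereal K \<le> g a"
      by (simp add: ereal_minus_le)
  qed
  then show ?thesis
    by (simp add: ereal_minus_le)
qed

lemma product_in_couplings:
  assumes "prob_space \<alpha>" "prob_space \<beta>"
  shows "\<alpha> \<Otimes>\<^sub>M \<beta> \<in> couplings \<alpha> \<beta>"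
proof -
  interpret \<alpha>: prob_space \<alpha> by fact
  interpret \<beta>: prob_space \<beta> by fact
  interpret pair_sigma_finite \<alpha> \<beta> ..
  have "distr (\<alpha> \<Otimes>\<^sub>M \<beta>) \<beta> snd = distr (\<beta> \<Otimes>\<^sub>M \<alpha>) \<beta> fst"
    by (subst distr_pair_swap) (simp add: distr_distr comp_def case_prod_unfold)
  then show ?thesis
    by (simp add: couplings_def prob_space_pair assms \<alpha>.distr_pair_fst \<beta>.distr_pair_fst)
qed

text \<open>
  Needed to subtract the unregularized cost in the extended reals. A bounded cost is integrable for
  every coupling, and the product coupling shows that the infimum is over a nonempty set.
\<close>

lemma OT_cost_finite:
  assumes "prob_space \<alpha>" "prob_space \<beta>"
    and c: "(\<lambda>p. c (fst p) (snd p)) \<in> borel_measurable (\<alpha> \<Otimes>\<^sub>M \<beta>)"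
    and bounded: "\<And>x y. x \<in> space \<alpha> \<Longrightarrow> y \<in> space \<beta> \<Longrightarrow> \<bar>c x y\<bar> \<le> B"
  shows "\<bar>OT_cost c \<alpha> \<beta>\<bar> \<noteq> \<infinity>"
proof -
  have "- B \<le> transport_cost c \<pi>" if "\<pi> \<in> couplings \<alpha> \<beta>" for \<pi>
  proof -
    have sets_\<pi>: "sets \<pi> = sets (\<alpha> \<Otimes>\<^sub>M \<beta>)" and "prob_space \<pi>"
      using that by (auto simp: couplings_def)
    interpret prob_space \<pi> by fact
    have sp: "space \<pi> = space \<alpha> \<times> space \<beta>"
      using sets_eq_imp_space_eq[OF sets_\<pi>] by (simp add: space_pair_measure)
    have "(\<lambda>p. c (fst p) (snd p)) \<in> borel_measurable \<pi>"
      using c by (simp add: measurable_cong_sets[OF sets_\<pi> refl])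
    then have int: "integrable \<pi> (\<lambda>p. c (fst p) (snd p))"
      using bounded by (intro integrable_const_bound[where B=B] AE_I2) (auto simp: sp)
    have "(\<integral>p. - B \<partial>\<pi>) \<le> (\<integral>p. c (fst p) (snd p) \<partial>\<pi>)"
      using int bounded by (intro integral_mono) (auto simp: sp abs_le_iff minus_le_iff)
    then show ?thesis
      by (simp add: transport_cost_def prob_space)
  qed
  then have "ereal (- B) \<le> OT_cost c \<alpha> \<beta>"
    unfolding OT_cost_def by (intro INF_greatest) simp
  moreover have "OT_cost c \<alpha> \<beta> \<le> ereal (transport_cost c (\<alpha> \<Otimes>\<^sub>M \<beta>))"
    unfolding OT_cost_def using product_in_couplings[OF assms(1,2)] by (rule INF_lower)
  ultimately show ?thesis
    by (cases "OT_cost c \<alpha> \<beta>") auto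
qed

lemma OT_cost_le_entropic_OT_cost:
  assumes "prob_space \<alpha>" "prob_space \<beta>" "0 < \<epsilon>"
  shows "OT_cost c \<alpha> \<beta> \<le> entropic_OT_cost \<epsilon> c \<alpha> \<beta>"
  unfolding OT_cost_def entropic_OT_cost_def
proof (rule INF_mono)
  fix \<pi> assume \<pi>: "\<pi> \<in> couplings \<alpha> \<beta>"
  have "0 \<le> relative_entropy \<pi> (\<alpha> \<Otimes>\<^sub>M \<beta>)"
    using \<pi> assms by (intro relative_entropy_nonneg prob_space_pair) (auto simp: couplings_def)
  then have "ereal (transport_cost c \<pi>) + 0
      \<le> ereal (transport_cost c \<pi>) + ereal \<epsilon> * relative_entropy \<pi> (\<alpha> \<Otimes>\<^sub>M \<beta>)"
    using assms(3) by (intro add_left_mono) simp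
  with \<pi> show "\<exists>\<pi>'\<in>couplings \<alpha> \<beta>. ereal (transport_cost c \<pi>')
      \<le> ereal (transport_cost c \<pi>) + ereal \<epsilon> * relative_entropy \<pi> (\<alpha> \<Otimes>\<^sub>M \<beta>)"
    by auto
qed

text \<open>
  Each coupling is compared with its own block approximation, and the infimum is taken afterwards.
\<close>

lemma entropic_OT_cost_le_coarsened:
  assumes prob: "prob_space \<alpha>" "prob_space \<beta>"
    and I: "finite J" "I \<in> measurable \<alpha> (count_space J)"
    and c: "(\<lambda>p. c (fst p) (snd p)) \<in> borel_measurable (\<alpha> \<Otimes>\<^sub>M \<beta>)"
    and bounded: "\<And>x y. x \<in> space \<alpha> \<Longrightarrow> y \<in> space \<beta> \<Longrightarrow> \<bar>c x y\<bar> \<le> B"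
    and osc: "\<And>x x' y. x \<in> space \<alpha> \<Longrightarrow> x' \<in> space \<alpha> \<Longrightarrow> y \<in> space \<beta> \<Longrightarrow> I x = I x' \<Longrightarrow>
      c x y \<le> c x' y + \<eta>"
    and \<epsilon>: "0 < \<epsilon>"
  shows "entropic_OT_cost \<epsilon> c \<alpha> \<beta> \<le> OT_cost c \<alpha> \<beta> + ereal (2 * \<eta> + \<epsilon> * ln (card J))"
  unfolding OT_cost_def entropic_OT_cost_def
proof (rule ereal_INF_le_INF_plus_const)
  fix \<pi> assume "\<pi> \<in> couplings \<alpha> \<beta>"
  then interpret coarsened_coupling \<alpha> \<beta> \<pi> I J
    using prob I by (simp add: coarsened_coupling_def)
  have "ereal \<epsilon> * relative_entropy block (\<alpha> \<Otimes>\<^sub>M \<beta>) \<le> ereal \<epsilon> * ereal (ln (card J))"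
    using \<epsilon> by (intro ereal_mult_left_mono relative_entropy_block) simp
  moreover have "transport_cost c block \<le> transport_cost c \<pi> + 2 * \<eta>"
    using bounded osc by (rule transport_cost_block[OF c])
  then have "ereal (transport_cost c block) \<le> ereal (transport_cost c \<pi> + 2 * \<eta>)"
    by simp
  ultimately have "ereal (transport_cost c block) + ereal \<epsilon> * relative_entropy block (\<alpha> \<Otimes>\<^sub>M \<beta>)
      \<le> ereal (transport_cost c \<pi> + 2 * \<eta>) + ereal \<epsilon> * ereal (ln (card J))"
    by (rule add_mono[rotated])
  also have "\<dots> = ereal (transport_cost c \<pi>) + ereal (2 * \<eta> + \<epsilon> * ln (card J))"
    by simp
  finally show "\<exists>\<pi>'\<in>couplings \<alpha> \<beta>.
      ereal (transport_cost c \<pi>') + ereal \<epsilon> * relative_entropy \<pi>' (\<alpha> \<Otimes>\<^sub>M \<beta>)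
      \<le> ereal (transport_cost c \<pi>) + ereal (2 * \<eta> + \<epsilon> * ln (card J))"
    using block_in_couplings by blast
qed

section \<open>Partition into cubes\<close>

text \<open>
  Cubes of side \<open>h\<close> with lower corner \<open>m\<close>. Cells are closed above, and the truncation of \<open>nat\<close> sends the
  left end point of each axis to cell 0 as well; so along each axis exactly \<open>n\<close> cells
  meet the closed interval of length \<open>n * h\<close> that starts at the corner.
\<close>

definition grid_cell :: "real ^ 'd \<Rightarrow> real \<Rightarrow> real ^ 'd \<Rightarrow> 'd \<Rightarrow> nat" where
  "grid_cell m h x = (\<lambda>j. nat (\<lceil>(x $ j - m $ j) / h\<rceil> - 1))"

lemma nat_ceiling_minus_1_eqD:
  fixes s t :: real
  assumes "0 \<le> s" "0 \<le> t" "nat (\<lceil>s\<rceil> - 1) = nat (\<lceil>t\<rceil> - 1)"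
  shows "\<bar>s - t\<bar> \<le> 1"
proof (cases "\<lceil>s\<rceil> \<le> 1 \<or> \<lceil>t\<rceil> \<le> 1")
  case True
  with assms(3) have "\<lceil>s\<rceil> \<le> 1" "\<lceil>t\<rceil> \<le> 1" by linarith+
  then have "s \<le> 1" "t \<le> 1" by linarith+
  with assms show ?thesis by linarith
next
  case False
  with assms(3) have "\<lceil>s\<rceil> = \<lceil>t\<rceil>" by linarith
  then show ?thesis by linarith
qed

lemma norm_le_sqrt_CARD:
  fixes v :: "real ^ 'd"
  assumes "\<And>j. \<bar>v $ j\<bar> \<le> h"
  shows "norm v \<le> sqrt (real CARD('d)) * h"
proof -
  have h: "0 \<le> h"
    using assms[of undefined] by linarith
  have "norm v \<le> norm (\<chi> j. h :: real ^ 'd)"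
    using assms h by (intro norm_le_componentwise_cart) simp
  also have "\<dots> = sqrt (real CARD('d)) * h"
    using h by (simp add: norm_vec_def L2_set_def real_sqrt_mult)
  finally show ?thesis .
qed

lemma dist_same_grid_cell:
  fixes x x' m :: "real ^ 'd"
  assumes "0 < h" "\<And>j. m $ j \<le> x $ j" "\<And>j. m $ j \<le> x' $ j"
    and same: "grid_cell m h x = grid_cell m h x'"
  shows "dist x x' \<le> sqrt (real CARD('d)) * h"
  unfolding dist_norm
proof (rule norm_le_sqrt_CARD)
  fix j
  have "\<bar>(x $ j - m $ j) / h - (x' $ j - m $ j) / h\<bar> \<le> 1"
    using assms(1-3) by (intro nat_ceiling_minus_1_eqD fun_cong[OF same[unfolded grid_cell_def]]) auto
  moreover have "(x $ j - m $ j) / h - (x' $ j - m $ j) / h = (x $ j - x' $ j) / h"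
    by (simp add: diff_divide_distrib)
  ultimately show "\<bar>(x - x') $ j\<bar> \<le> h"
    using \<open>0 < h\<close> by (simp add: abs_divide)
qed

lemma grid_cell_bounded:
  fixes x m :: "real ^ 'd"
  assumes "0 < n" "0 < D" "\<And>j. x $ j \<le> m $ j + D"
  shows "grid_cell m (D / real n) x \<in> UNIV \<rightarrow>\<^sub>E {..<n}"
proof -
  have "nat (\<lceil>(x $ j - m $ j) / (D / real n)\<rceil> - 1) < n" for j
  proof -
    have "(x $ j - m $ j) / (D / real n) = (x $ j - m $ j) / D * real n"
      by simp
    also have "\<dots> \<le> 1 * real n"
      using assms(2) assms(3)[of j] by (intro mult_right_mono) (auto simp: divide_le_eq)
    finally have "\<lceil>(x $ j - m $ j) / (D / real n)\<rceil> \<le> int n"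
      by (simp add: ceiling_le_iff)
    with \<open>0 < n\<close> show ?thesis by linarith
  qed
  then show ?thesis
    by (auto simp: grid_cell_def)
qed

text \<open>
  No coordinate varies by more than the diameter, so the coordinatewise infimum is the corner of a
  cube of side \<open>D\<close> that contains the set.
\<close>

lemma bounded_lower_corner:
  fixes X :: "(real ^ 'd) set"
  assumes "bounded X" "X \<noteq> {}" "diameter X \<le> D"
  obtains m :: "real ^ 'd"
  where "\<And>x j. x \<in> X \<Longrightarrow> m $ j \<le> x $ j" "\<And>x j. x \<in> X \<Longrightarrow> x $ j \<le> m $ j + D"
proof
  define m :: "real ^ 'd" where "m = (\<chi> j. INF x\<in>X. x $ j)"
  have close: "x $ j - D \<le> x' $ j" if "x \<in> X" "x' \<in> X" for x x' j
  proof -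
    have "\<bar>(x - x') $ j\<bar> \<le> dist x x'"
      unfolding dist_norm by (rule component_le_norm_cart)
    also have "\<dots> \<le> D"
      using diameter_bounded_bound[OF assms(1) that] assms(3) by linarith
    finally show ?thesis by (simp add: abs_le_iff)
  qed
  fix x j assume x: "x \<in> X"
  have "bdd_below ((\<lambda>x. x $ j) ` X)"
    using close[OF x] by (intro bdd_belowI2) auto
  then show "m $ j \<le> x $ j"
    using x by (auto simp: m_def intro: cINF_lower)
  have "x $ j - D \<le> m $ j"
    using assms(2) close[OF x] by (auto simp: m_def intro: cINF_greatest)
  then show "x $ j \<le> m $ j + D" by simp
qed

text \<open>
  \<open>X\<close> may fail to be a Borel set: coordinates are still measurable for the trace of the Borel sets.
\<close>

lemma measurable_grid_cell:
  fixes m :: "real ^ 'd"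
  assumes M: "sets M = sets (restrict_space borel X)"
    and J: "finite J" "\<And>x. x \<in> X \<Longrightarrow> grid_cell m h x \<in> J"
  shows "grid_cell m h \<in> measurable M (count_space J)"
  unfolding measurable_count_space_eq2[OF J(1)]
proof (intro conjI ballI)
  have sp: "space M = X"
    using sets_eq_imp_space_eq[OF M] by (simp add: space_restrict_space)
  show "grid_cell m h \<in> space M \<rightarrow> J"
    using J sp by auto
  have [measurable]: "(\<lambda>x. x $ j) \<in> borel_measurable M" for j
    unfolding measurable_cong_sets[OF M refl]
    by (intro measurable_restrict_space1 borel_measurable_continuous_onI continuous_intros)
  fix k
  have "grid_cell m h -` {k} \<inter> space M =
      {x \<in> space M. \<forall>j. nat (\<lceil>(x $ j - m $ j) / h\<rceil> - 1) = k j}"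
    by (auto simp: grid_cell_def)
  also have "\<dots> \<in> sets M"
    by measurable
  finally show "grid_cell m h -` {k} \<inter> space M \<in> sets M" .
qed

section \<open>Separately Lipschitz costs\<close>

text \<open>
  The common Lipschitz constant makes separate continuity joint. Measurability of the cost on the
  product space rests on this.
\<close>

lemma continuous_on_separately_lipschitz:
  fixes c :: "'a::metric_space \<Rightarrow> 'b::metric_space \<Rightarrow> real"
  assumes cx: "\<And>y. y \<in> Y \<Longrightarrow> L-lipschitz_on X (\<lambda>x. c x y)"
    and cy: "\<And>x. x \<in> X \<Longrightarrow> L-lipschitz_on Y (\<lambda>y. c x y)"
  shows "continuous_on (X \<times> Y) (\<lambda>p. c (fst p) (snd p))"
  unfolding continuous_on_def
proof
  fix p assume p: "p \<in> X \<times> Y"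
  let ?d = "\<lambda>q. L * dist (fst q) (fst p) + L * dist (snd q) (snd p)"
  have "((\<lambda>q. c (fst q) (snd q) - c (fst p) (snd p)) \<longlongrightarrow> 0) (at p within X \<times> Y)"
  proof (rule Lim_null_comparison)
    show "\<forall>\<^sub>F q in at p within X \<times> Y. norm (c (fst q) (snd q) - c (fst p) (snd p)) \<le> ?d q"
      unfolding eventually_at_filter
    proof (intro always_eventually allI impI)
      fix q assume "q \<in> X \<times> Y"
      then have "dist (c (fst q) (snd q)) (c (fst p) (snd q)) \<le> L * dist (fst q) (fst p)"
        and "dist (c (fst p) (snd q)) (c (fst p) (snd p)) \<le> L * dist (snd q) (snd p)"
        using p cx[THEN lipschitz_onD] cy[THEN lipschitz_onD] by auto
      then show "norm (c (fst q) (snd q) - c (fst p) (snd p)) \<le> ?d q"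
        by (simp add: dist_real_def)
    qed
    have "(?d \<longlongrightarrow> L * dist (fst p) (fst p) + L * dist (snd p) (snd p)) (at p within X \<times> Y)"
      by (intro tendsto_intros)
    then show "(?d \<longlongrightarrow> 0) (at p within X \<times> Y)" by simp
  qed
  then show "((\<lambda>p. c (fst p) (snd p)) \<longlongrightarrow> c (fst p) (snd p)) (at p within X \<times> Y)"
    by (rule LIM_zero_cancel)
qed

lemma separately_lipschitz_bounded:
  fixes c :: "'a::metric_space \<Rightarrow> 'b::metric_space \<Rightarrow> real"
  assumes "bounded X" "bounded Y"
    and cx: "\<And>y. y \<in> Y \<Longrightarrow> L-lipschitz_on X (\<lambda>x. c x y)"
    and cy: "\<And>x. x \<in> X \<Longrightarrow> L-lipschitz_on Y (\<lambda>y. c x y)"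
  obtains B where "\<And>x y. x \<in> X \<Longrightarrow> y \<in> Y \<Longrightarrow> \<bar>c x y\<bar> \<le> B"
proof (cases "X = {} \<or> Y = {}")
  case False
  then obtain x0 y0 where x0: "x0 \<in> X" and y0: "y0 \<in> Y" by auto
  have L: "0 \<le> L"
    using cx[OF y0] by (rule lipschitz_on_nonneg)
  show thesis
  proof
    fix x y assume x: "x \<in> X" and y: "y \<in> Y"
    have "dist (c x y) (c x0 y) \<le> L * dist x x0"
      using cx[OF y] x x0 by (rule lipschitz_onD)
    also have "\<dots> \<le> L * diameter X"
      using L diameter_bounded_bound[OF assms(1) x x0] by (rule mult_left_mono[rotated])
    finally have 1: "dist (c x y) (c x0 y) \<le> L * diameter X" .
    have "dist (c x0 y) (c x0 y0) \<le> L * dist y y0"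
      using cy[OF x0] y y0 by (rule lipschitz_onD)
    also have "\<dots> \<le> L * diameter Y"
      using L diameter_bounded_bound[OF assms(2) y y0] by (rule mult_left_mono[rotated])
    finally have "dist (c x0 y) (c x0 y0) \<le> L * diameter Y" .
    with 1 show "\<bar>c x y\<bar> \<le> \<bar>c x0 y0\<bar> + L * diameter X + L * diameter Y"
      by (simp add: dist_real_def)
  qed
qed (use that in blast)

section \<open>The rate\<close>

text \<open>
  Numerical form of the choice of the grid: here \<open>s = L D / (sqrt d \<epsilon>)\<close>, the first summand is the error in
  the transport cost, the second is the entropy, both per dimension and divided by \<open>\<epsilon>\<close>. For \<open>s > 1\<close> rounding
  up costs at most a factor 2 inside the logarithm. For \<open>s \<le> 1\<close> there is a single cell, and
  \<open>2 s \<le> 2 \<le> 2 (2 + ln s)\<close> because \<open>s \<ge> exp (-1)\<close>.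
\<close>

lemma grid_size_tradeoff:
  fixes s :: real
  assumes "exp (- 1) \<le> s"
  defines "n \<equiv> nat \<lceil>s\<rceil>"
  shows "2 * s / real n + ln (real n) \<le> 2 * (2 + ln s)"
proof -
  have s: "0 < s"
    using assms(1) exp_gt_zero[of "-1::real"] by linarith
  have ln_s: "- 1 \<le> ln s"
    using assms(1) s by (simp add: ln_ge_iff)
  have n: "s \<le> real n" "real n < s + 1" "0 < n"
    using s by (auto simp: n_def) linarith+
  have "2 * s / real n \<le> 2"
    using n s by (simp add: divide_le_eq)
  moreover have "ln (real n) \<le> 1 + ln s" if "1 < s"
  proof -
    have "ln (real n) \<le> ln (2 * s)"
      using n that by (subst ln_le_cancel_iff) auto
    also have "\<dots> = ln 2 + ln s"
      using s by (simp add: ln_mult)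
    also have "ln 2 \<le> (1::real)"
      using ln_le_minus_one[of "2::real"] by simp
    finally show ?thesis by simp
  qed
  moreover have "n = 1" if "\<not> 1 < s"
    using that s by (simp add: n_def) linarith
  ultimately show ?thesis
    using ln_s by (cases "1 < s") auto
qed

text \<open>
  Partition a cube of side \<open>D\<close> around \<open>X\<close> into \<open>n ^ d\<close> cubes. Cells have diameter at most
  \<open>sqrt d * D / n\<close>, over which the cost varies by at most \<open>L\<close> times as much.
\<close>

lemma entropic_OT_cost_gap_bound:
  fixes X Y :: "(real ^ 'd) set" and c :: "real ^ 'd \<Rightarrow> real ^ 'd \<Rightarrow> real"
  assumes \<alpha>: "prob_measure_on X \<alpha>" and \<beta>: "prob_measure_on Y \<beta>"
    and X: "bounded X" "diameter X \<le> D" and Y: "bounded Y"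
    and pos: "0 < L" "0 < D" "0 < \<epsilon>" "0 < n"
    and cx: "\<And>y. y \<in> Y \<Longrightarrow> L-lipschitz_on X (\<lambda>x. c x y)"
    and cy: "\<And>x. x \<in> X \<Longrightarrow> L-lipschitz_on Y (\<lambda>y. c x y)"
  shows "entropic_OT_cost \<epsilon> c \<alpha> \<beta> - OT_cost c \<alpha> \<beta> \<le>
    ereal (2 * (L * (sqrt (real CARD('d)) * (D / real n))) + \<epsilon> * (real CARD('d) * ln (real n)))"
proof -
  have prob: "prob_space \<alpha>" "prob_space \<beta>"
    and sets: "sets \<alpha> = sets (restrict_space borel X)" "sets \<beta> = sets (restrict_space borel Y)"
    using \<alpha> \<beta> by (auto simp: prob_measure_on_def)
  have sp: "space \<alpha> = X" "space \<beta> = Y"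
    using sets[THEN sets_eq_imp_space_eq] by (simp_all add: space_restrict_space)
  have "X \<noteq> {}"
    using prob_space.not_empty[OF prob(1)] sp by simp
  obtain m where m: "\<And>x j. x \<in> X \<Longrightarrow> m $ j \<le> x $ j" "\<And>x j. x \<in> X \<Longrightarrow> x $ j \<le> m $ j + D"
    using bounded_lower_corner[OF X(1) \<open>X \<noteq> {}\<close> X(2)] by blast
  let ?I = "grid_cell m (D / real n)" and ?J = "(UNIV :: 'd set) \<rightarrow>\<^sub>E {..<n}"
  have J: "finite ?J"
    by (intro finite_PiE) auto
  have card_J: "real (card ?J) = real n ^ CARD('d)"
    by (simp add: card_PiE)
  have I: "?I \<in> measurable \<alpha> (count_space ?J)"
    using m(2) pos by (intro measurable_grid_cell[OF sets(1) J] grid_cell_bounded) auto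
  have "(\<lambda>x. x) \<in> measurable \<alpha> borel" "(\<lambda>x. x) \<in> measurable \<beta> borel"
    unfolding measurable_cong_sets[OF sets(1) refl] measurable_cong_sets[OF sets(2) refl]
    by (auto intro: measurable_restrict_space1)
  then have "(\<lambda>p. (fst p, snd p)) \<in> measurable (\<alpha> \<Otimes>\<^sub>M \<beta>) borel"
    using measurable_compose[OF measurable_fst, of "\<lambda>x. x" \<alpha> borel \<beta>]
      measurable_compose[OF measurable_snd, of "\<lambda>x. x" \<beta> borel \<alpha>]
    by (intro borel_measurable_Pair) auto
  then have "(\<lambda>p. p) \<in> measurable (\<alpha> \<Otimes>\<^sub>M \<beta>) (restrict_space borel (X \<times> Y))"
    by (intro measurable_restrict_space2) (auto simp: space_pair_measure sp)
  then have c: "(\<lambda>p. c (fst p) (snd p)) \<in> borel_measurable (\<alpha> \<Otimes>\<^sub>M \<beta>)"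
    using continuous_on_separately_lipschitz[OF cx cy]
    by (rule measurable_compose[OF _ borel_measurable_continuous_on_restrict])
  obtain B where B: "\<And>x y. x \<in> X \<Longrightarrow> y \<in> Y \<Longrightarrow> \<bar>c x y\<bar> \<le> B"
    using separately_lipschitz_bounded[OF X(1) Y cx cy] by blast
  have osc: "c x y \<le> c x' y + L * (sqrt (real CARD('d)) * (D / real n))"
    if "x \<in> X" "x' \<in> X" "y \<in> Y" "?I x = ?I x'" for x x' y
  proof -
    have "dist (c x y) (c x' y) \<le> L * dist x x'"
      using cx[OF that(3)] that(1,2) by (rule lipschitz_onD)
    also have "\<dots> \<le> L * (sqrt (real CARD('d)) * (D / real n))"
      using pos m(1) that by (intro mult_left_mono dist_same_grid_cell) auto
    finally show ?thesis
      by (simp add: dist_real_def abs_le_iff)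
  qed
  have "entropic_OT_cost \<epsilon> c \<alpha> \<beta> \<le> OT_cost c \<alpha> \<beta> +
      ereal (2 * (L * (sqrt (real CARD('d)) * (D / real n))) + \<epsilon> * ln (card ?J))"
    using B osc pos(3) by (rule entropic_OT_cost_le_coarsened[OF prob J I c, unfolded sp])
  moreover have "\<bar>OT_cost c \<alpha> \<beta>\<bar> \<noteq> \<infinity>"
    using B by (rule OT_cost_finite[OF prob c, unfolded sp])
  moreover have "ln (real (card ?J)) = real CARD('d) * ln (real n)"
    using pos(4) by (simp add: card_J ln_realpow)
  ultimately show ?thesis
    by (auto simp: ereal_minus_le_iff add.commute)
qed

text \<open>
  Up to the common factor, the scale \<open>A\<close> only adds the constant \<open>ln A\<close> to the unbounded \<open>ln (1 / \<epsilon>)\<close>.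
\<close>

lemma asymp_equiv_mult_ln_scale:
  fixes A d :: real
  assumes "0 < A" "0 < d"
  shows "(\<lambda>\<epsilon>. 2 * \<epsilon> * d * ln (A / \<epsilon>)) \<sim>[at_right 0] (\<lambda>\<epsilon>. 2 * \<epsilon> * d * ln (1 / \<epsilon>))"
  using assms by real_asymp

theorem theorem1:
  fixes X Y :: "(real ^ 'd) set"
    and \<alpha> \<beta> :: "(real ^ 'd) measure"
    and c :: "real ^ 'd \<Rightarrow> real ^ 'd \<Rightarrow> real"
    and L D :: real
  assumes "prob_measure_on X \<alpha>" and "prob_measure_on Y \<beta>"
    and "bounded X" and "bounded Y"
    and "diameter X = diameter Y" and "diameter Y \<le> D"
    and "L > 0" and "D > 0"
    and "\<And>y. y \<in> Y \<Longrightarrow> L-lipschitz_on X (\<lambda>x. c x y)"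
    and "\<And>x. x \<in> X \<Longrightarrow> L-lipschitz_on Y (\<lambda>y. c x y)"
  shows "(\<forall>\<epsilon>>0.
            0 \<le> entropic_OT_cost \<epsilon> c \<alpha> \<beta> - OT_cost c \<alpha> \<beta> \<and>
            (sqrt (real CARD('d)) * \<epsilon> \<le> exp 1 * L * D \<longrightarrow>
             entropic_OT_cost \<epsilon> c \<alpha> \<beta> - OT_cost c \<alpha> \<beta>
               \<le> ereal (2 * \<epsilon> * real CARD('d) *
                    ln (exp 2 * L * D / (sqrt (real CARD('d)) * \<epsilon>))))) \<and>
         (\<lambda>\<epsilon>. 2 * \<epsilon> * real CARD('d) *
                    ln (exp 2 * L * D / (sqrt (real CARD('d)) * \<epsilon>)))
           \<sim>[at_right 0] (\<lambda>\<epsilon>. 2 * \<epsilon> * real CARD('d) * ln (1 / \<epsilon>))"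
proof (intro conjI allI impI)
  have prob: "prob_space \<alpha>" "prob_space \<beta>"
    using assms(1,2) by (auto simp: prob_measure_on_def)
  let ?d = "real CARD('d)"
  fix \<epsilon> :: real assume \<epsilon>: "0 < \<epsilon>"
  show "0 \<le> entropic_OT_cost \<epsilon> c \<alpha> \<beta> - OT_cost c \<alpha> \<beta>"
    by (intro ereal_diff_positive OT_cost_le_entropic_OT_cost prob \<epsilon>)
  assume small: "sqrt ?d * \<epsilon> \<le> exp 1 * L * D"
  define s where "s = L * D / (sqrt ?d * \<epsilon>)"
  have s_pos: "0 < s"
    using assms(7,8) \<epsilon> by (simp add: s_def)
  have s_ge: "exp (- 1) \<le> s"
    using small \<epsilon> by (simp add: s_def exp_minus field_simps)
  have LD: "L * D = s * (sqrt ?d * \<epsilon>)"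
    using \<epsilon> by (simp add: s_def)
  define n where "n = nat \<lceil>s\<rceil>"
  have n: "0 < n"
    using s_pos by (simp add: n_def)
  have "2 * (L * (sqrt ?d * (D / real n))) + \<epsilon> * (?d * ln (real n)) =
      \<epsilon> * ?d * (2 * s / real n + ln (real n))"
  proof -
    have "L * (sqrt ?d * (D / real n)) = (L * D) * sqrt ?d / real n"
      by (simp only: times_divide_eq_right mult_ac)
    also have "\<dots> = \<epsilon> * (sqrt ?d * sqrt ?d) * s / real n"
      by (subst LD) (simp only: mult_ac)
    also have "sqrt ?d * sqrt ?d = ?d"
      by simp
    finally show ?thesis
      by (simp add: algebra_simps)
  qed
  also have "\<dots> \<le> \<epsilon> * ?d * (2 * (2 + ln s))"
    using \<epsilon> grid_size_tradeoff[OF s_ge] unfolding n_def by (intro mult_left_mono) auto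
  also have "\<dots> = 2 * \<epsilon> * ?d * ln (exp 2 * s)"
    using s_pos by (simp add: ln_mult)
  also have "exp 2 * s = exp 2 * L * D / (sqrt ?d * \<epsilon>)"
    by (simp add: s_def)
  finally have num: "2 * (L * (sqrt ?d * (D / real n))) + \<epsilon> * (?d * ln (real n)) \<le>
      2 * \<epsilon> * ?d * ln (exp 2 * L * D / (sqrt ?d * \<epsilon>))" .
  have "entropic_OT_cost \<epsilon> c \<alpha> \<beta> - OT_cost c \<alpha> \<beta> \<le>
      ereal (2 * (L * (sqrt ?d * (D / real n))) + \<epsilon> * (?d * ln (real n)))"
    using assms \<epsilon> n by (intro entropic_OT_cost_gap_bound[where X=X and Y=Y]) auto
  also have "\<dots> \<le> ereal (2 * \<epsilon> * ?d * ln (exp 2 * L * D / (sqrt ?d * \<epsilon>)))"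
    using num by simp
  finally show "entropic_OT_cost \<epsilon> c \<alpha> \<beta> - OT_cost c \<alpha> \<beta> \<le>
      ereal (2 * \<epsilon> * ?d * ln (exp 2 * L * D / (sqrt ?d * \<epsilon>)))" .
next
  define A where "A = exp 2 * L * D / sqrt (real CARD('d))"
  have A: "0 < A"
    using assms(7,8) by (simp add: A_def)
  have "(\<lambda>\<epsilon>. 2 * \<epsilon> * real CARD('d) * ln (A / \<epsilon>)) \<sim>[at_right 0]
      (\<lambda>\<epsilon>. 2 * \<epsilon> * real CARD('d) * ln (1 / \<epsilon>))"
    by (rule asymp_equiv_mult_ln_scale) (use A in auto)
  then show "(\<lambda>\<epsilon>. 2 * \<epsilon> * real CARD('d) *
                    ln (exp 2 * L * D / (sqrt (real CARD('d)) * \<epsilon>)))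
           \<sim>[at_right 0] (\<lambda>\<epsilon>. 2 * \<epsilon> * real CARD('d) * ln (1 / \<epsilon>))"
    by (simp add: A_def)
qed

end
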